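(* Let $k$ be a finite ordinal or $\omega$, let $\langle X_i:i<k\rangle$ be a sequence of Tychonoff spaces, and for each $i<k$ let $A_i$ be a $C$-embedded subspace of $X_i$ that is closed in $X_i$, Lindelöf, and Čech-complete. Then the product $\prod_{i<k}A_i$ is Lindelöf, Čech-complete, and $C$-embedded in $\prod_{i<k}X_i$.
   Context: A subspace $A$ of a space $X$ is $C$-embedded in $X$ if every continuous function from $A$ to $\mathbb{R}$ admits a continuous extension to $X$. A Tychonoff space is Čech-complete if it is a $G_\delta$-subset of (some, equivalently every) Hausdorff compactification of it. Products carry the product topology. *)

theory Defs
  imports "HOL-Analysis.Analysis" "HOL-Library.Extended_Nat"
begin

definition C_embedded_in :: "'a topology \<Rightarrow> 'a set \<Rightarrow> bool" where
  "C_embedded_in X A \<longleftrightarrow> A \<subseteq> topspace X \<and>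
     (\<forall>f. continuous_map (subtopology X A) euclideanreal f \<longrightarrow>
        (\<exists>g. continuous_map X euclideanreal g \<and> (\<forall>x\<in>A. g x = f x)))"

text \<open>The library's complete regularity includes no separation axiom.\<close>

definition Tychonoff_space :: "'a topology \<Rightarrow> bool" where
  "Tychonoff_space X \<longleftrightarrow> completely_regular_space X \<and> Hausdorff_space X"

definition Hausdorff_compactification ::
    "'a topology \<Rightarrow> 'b topology \<Rightarrow> ('a \<Rightarrow> 'b) \<Rightarrow> bool" where
  "Hausdorff_compactification X K e \<longleftrightarrow>
     compact_space K \<and> Hausdorff_space K \<and> embedding_map X K e \<and>
     K closure_of (e ` topspace X) = topspace K"

text \<open>
  A definition cannot quantify over the type of the points of \<open>K\<close>. The type \<^typ>\<open>'a set set\<close> is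
  large enough for every Hausdorff compactification of \<open>X\<close>: a point is determined by the traces
  of its open neighbourhoods on \<open>X\<close>. So the existential below ranges over all Hausdorff
  compactifications up to homeomorphism; see \<open>Cech_completeI\<close>.
\<close>

definition Cech_complete_space :: "'a topology \<Rightarrow> bool" where
  "Cech_complete_space X \<longleftrightarrow> Tychonoff_space X \<and>
     (\<exists>(K :: 'a set set topology) e.
        Hausdorff_compactification X K e \<and> gdelta_in K (e ` topspace X))"

lemma Hausdorff_compactification_transfer:
  fixes X :: "'a topology" and K :: "'b topology"
  assumes "Hausdorff_compactification X K e"
  obtains K' :: "'a set set topology" and h where
    "homeomorphic_map K K' h" "Hausdorff_compactification X K' (h \<circ> e)"
proof -
  have cK: "compact_space K" and hK: "Hausdorff_space K" and em: "embedding_map X K e"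
    and dense: "K closure_of (e ` topspace X) = topspace K"
    using assms by (auto simp: Hausdorff_compactification_def)
  define h where "h k = {{x \<in> topspace X. e x \<in> U} |U. openin K U \<and> k \<in> U}" for k
  have inj: "inj_on h (topspace K)"
  proof (rule inj_onI, rule ccontr)
    fix k l assume k: "k \<in> topspace K" and l: "l \<in> topspace K" and eq: "h k = h l" and "k \<noteq> l"
    then obtain U V where UV: "openin K U" "openin K V" "k \<in> U" "l \<in> V" "disjnt U V"
      using hK unfolding Hausdorff_space_def by meson
    have "{x \<in> topspace X. e x \<in> U} \<in> h l"
      using UV unfolding eq[symmetric] by (auto simp: h_def)
    then obtain W where W: "openin K W" "l \<in> W"
        "{x \<in> topspace X. e x \<in> U} = {x \<in> topspace X. e x \<in> W}"
      unfolding h_def by auto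
    have "openin K (V \<inter> W)" "l \<in> V \<inter> W"
      using UV W by auto
    moreover have "l \<in> K closure_of (e ` topspace X)"
      using l dense by simp
    ultimately obtain y where "y \<in> e ` topspace X" "y \<in> V \<inter> W"
      unfolding in_closure_of by blast
    then show False
      using W(3) UV(5) unfolding disjnt_def by blast
  qed
  define g where "g = inv_into (topspace K) h"
  define K' where "K' = pullback_topology (h ` topspace K) g K"
  have gh: "g (h k) = k" if "k \<in> topspace K" for k
    using that inj by (simp add: g_def)
  have top: "topspace K' = h ` topspace K"
    unfolding K'_def topspace_pullback_topology using gh by auto
  have op: "openin K' S \<longleftrightarrow> (\<exists>U. openin K U \<and> S = h ` U)" for S
  proof -
    have "g -` U \<inter> h ` topspace K = h ` U" if "openin K U" for U
      using openin_subset[OF that] gh by force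
    then show ?thesis
      unfolding K'_def openin_pullback_topology by metis
  qed
  have homeo: "homeomorphic_map K K' h"
  proof (rule bijective_open_imp_homeomorphic_map)
    show "open_map K K' h"
      by (auto simp: open_map_def op)
    show "continuous_map K K' h"
      unfolding continuous_map
    proof (intro conjI allI impI)
      show "h ` topspace K \<subseteq> topspace K'" using top by simp
      fix S assume "openin K' S"
      then obtain U where U: "openin K U" "S = h ` U" using op by auto
      then have "{x \<in> topspace K. h x \<in> S} = U"
        using openin_subset[OF U(1)] inj by (auto dest: inj_onD)
      then show "openin K {x \<in> topspace K. h x \<in> S}" using U by simp
    qed
  qed (use top inj in auto)
  have "compact_space K'" "Hausdorff_space K'"
    using cK hK homeomorphic_map_imp_homeomorphic_space[OF homeo]
    by (auto simp: homeomorphic_compact_space homeomorphic_Hausdorff_space)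
  moreover have "embedding_map X K' (h \<circ> e)"
  proof (rule embedding_map_compose[OF em])
    show "embedding_map K K' h"
      using homeo top by (metis embedding_map_def subtopology_topspace)
  qed
  moreover have "K' closure_of ((h \<circ> e) ` topspace X) = topspace K'"
  proof -
    have "e ` topspace X \<subseteq> topspace K"
      using homeomorphic_imp_surjective_map[OF em[unfolded embedding_map_def]]
      unfolding topspace_subtopology by blast
    then have "K' closure_of (h ` e ` topspace X) = h ` (K closure_of (e ` topspace X))"
      by (rule homeomorphic_map_closure_of[OF homeo])
    then show ?thesis
      using dense top by (simp add: image_comp)
  qed
  ultimately show ?thesis
    using homeo that by (simp add: Hausdorff_compactification_def)
qed

lemma homeomorphic_map_gdelta_in:
  assumes "homeomorphic_map K K' h" "gdelta_in K S"
  shows "gdelta_in K' (h ` S)"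
proof -
  obtain g where g: "homeomorphic_maps K K' h g"
    using assms(1) homeomorphic_map_maps by blast
  have S: "S \<subseteq> topspace K"
    using assms(2) by (rule gdelta_in_subset)
  obtain \<U> where U: "countable \<U>" "\<And>U. U \<in> \<U> \<Longrightarrow> openin K U" "topspace K \<inter> \<Inter>\<U> = S"
    using assms(2) unfolding gdelta_in_def relative_to_def intersection_of_def by blast
  define \<V> where "\<V> = (\<lambda>U. {y \<in> topspace K'. g y \<in> U}) ` \<U>"
  have cont: "continuous_map K' K g"
    using g by (simp add: homeomorphic_maps_def)
  have "countable \<V>" "\<V> \<subseteq> Collect (openin K')"
    using U cont by (auto simp: \<V>_def intro: openin_continuous_map_preimage)
  then have "gdelta_in K' (topspace K' \<inter> \<Inter>\<V>)"
    unfolding gdelta_in_def relative_to_def intersection_of_def by blast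
  moreover have "topspace K' \<inter> \<Inter>\<V> = {y \<in> topspace K'. g y \<in> S}"
    using continuous_map_image_subset_topspace[OF cont] U(3) by (auto simp: \<V>_def)
  moreover have "{y \<in> topspace K'. g y \<in> S} = h ` S"
    using g S unfolding homeomorphic_maps_def continuous_map by force
  ultimately show ?thesis by simp
qed

lemma Cech_completeI:
  fixes X :: "'a topology" and K :: "'b topology"
  assumes "Tychonoff_space X" "Hausdorff_compactification X K e" "gdelta_in K (e ` topspace X)"
  shows "Cech_complete_space X"
  using assms(2)
proof (rule Hausdorff_compactification_transfer)
  fix K' :: "'a set set topology" and h
  assume "homeomorphic_map K K' h" "Hausdorff_compactification X K' (h \<circ> e)"
  then show ?thesis
    using assms(1,3) homeomorphic_map_gdelta_in[of K K' h "e ` topspace X"]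
    unfolding Cech_complete_space_def by (metis image_comp)
qed

end

theory Submission
  imports Defs
begin

text \<open>
  The proof rests on a characterization due to Frolik: a Tychonoff space is Lindelof and
  Cech-complete if and only if it admits a continuous proper map into a countable power of the
  real line. The forward direction is \<open>Lindelof_Cech_complete_imp_proper_map\<close>; the converse is
  \<open>Tychonoff_proper_map_imp_Cech_complete\<close> together with the fact that preimages of Lindelof
  spaces under proper maps are Lindelof.

  Such maps behave well in both respects that matter. A countable product of them is again such a
  map (\<open>proper_map_into_fun_product\<close>), so the product of the \<open>A i\<close> is Lindelof and
  Cech-complete. And since its values are families of reals, a map of this kind on \<open>A i\<close>
  extends to \<open>X i\<close>, coordinate by coordinate, when \<open>A i\<close> is \<open>C\<close>-embedded. Hence there is a
  continuous map \<open>\<Psi>\<close> from the product of the \<open>X i\<close> into a countable power of the real line whose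
  restriction to the product of the \<open>A i\<close> is proper.

  This alone gives \<open>C\<close>-embedding (\<open>C_embedded_in_if_proper_map_extends\<close>): if \<open>e\<close> embeds the
  product of the \<open>X i\<close> into a compact Hausdorff space \<open>Q\<close>, then \<open>(e, \<Psi>)\<close> maps it into the product of \<open>Q\<close> and the
  power of the line, a normal space, and maps the product of the \<open>A i\<close> onto a closed subset
  homeomorphically. A real function on that closed subset extends by Tietze's theorem, and
  composing with \<open>(e, \<Psi>)\<close> gives the required extension.
\<close>

section \<open>Powers of the real line\<close>

lemma continuous_map_euclidean_fun:
  "continuous_map X (euclidean :: ('n \<Rightarrow> 'b::topological_space) topology) f \<longleftrightarrow>
     (\<forall>n. continuous_map X euclidean (\<lambda>x. f x n))"
  unfolding euclidean_product_topology[symmetric] continuous_map_componentwise_UNIV by simp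

lemma second_countable_euclidean:
  "second_countable (euclidean :: 'a::second_countable_topology topology)"
proof -
  obtain B :: "'a set set" where "countable B" "topological_basis B"
    using ex_countable_basis by blast
  then show ?thesis
    unfolding second_countable_def open_openin[symmetric]
    using topological_basis_open topological_basisE by metis
qed

text \<open>
  Used with \<open>ln\<close>, to make a family of positive functions real-valued, and with \<open>arctan\<close>, to
  place a power of the real line inside a compact cube.
\<close>

lemma homeomorphic_map_componentwise:
  fixes f :: "real \<Rightarrow> real"
  assumes "continuous_on S f" "continuous_on T g" "f ` S \<subseteq> T" "g ` T \<subseteq> S"
    "\<And>x. x \<in> S \<Longrightarrow> g (f x) = x" "\<And>y. y \<in> T \<Longrightarrow> f (g y) = y"
  shows "homeomorphic_map (top_of_set {y :: 'n \<Rightarrow> real. \<forall>n. y n \<in> S})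
     (top_of_set {y. \<forall>n. y n \<in> T}) (\<lambda>y n. f (y n))"
proof -
  have *: "continuous_map (top_of_set {y :: 'n \<Rightarrow> real. \<forall>n. y n \<in> S})
     (top_of_set {y. \<forall>n. y n \<in> T}) (\<lambda>y n. f (y n))"
    if "continuous_on S f" "f ` S \<subseteq> T" for f :: "real \<Rightarrow> real" and S T
    unfolding continuous_map_in_subtopology continuous_map_euclidean_fun
  proof safe
    fix n :: 'n
    have "continuous_on {y :: 'n \<Rightarrow> real. \<forall>n. y n \<in> S} (\<lambda>y. f (y n))"
      by (rule continuous_on_compose2[OF that(1)])
        (auto intro: continuous_on_subset[OF continuous_on_product_coordinates])
    then show "continuous_map (top_of_set {y :: 'n \<Rightarrow> real. \<forall>n. y n \<in> S}) euclidean (\<lambda>y. f (y n))"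
      by simp
  qed (use that(2) in auto)
  have "homeomorphic_maps (top_of_set {y :: 'n \<Rightarrow> real. \<forall>n. y n \<in> S})
     (top_of_set {y. \<forall>n. y n \<in> T}) (\<lambda>y n. f (y n)) (\<lambda>y n. g (y n))"
    unfolding homeomorphic_maps_def using *[of S f T] *[of T g S] assms by auto
  then show ?thesis
    using homeomorphic_map_maps by blast
qed

section \<open>Tychonoff spaces and embeddings\<close>

lemma Tychonoff_space_subtopology:
  "Tychonoff_space X \<Longrightarrow> Tychonoff_space (subtopology X S)"
  by (simp add: Tychonoff_space_def completely_regular_space_subtopology Hausdorff_space_subtopology)

lemma Tychonoff_space_product_topology:
  assumes "\<And>i. i \<in> I \<Longrightarrow> Tychonoff_space (X i)"
  shows "Tychonoff_space (product_topology X I)"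
  using assms by (simp add: Tychonoff_space_def completely_regular_space_product_topology
      Hausdorff_space_product_topology)

lemma Tychonoff_imp_embedding_in_compact_Hausdorff:
  fixes X :: "'a topology"
  assumes "Tychonoff_space X"
  obtains Q :: "(('a \<Rightarrow> real) \<Rightarrow> real) topology" and e
  where "compact_space Q" "Hausdorff_space Q" "embedding_map X Q e"
proof -
  have "completely_regular_space X" "Hausdorff_space X"
    using assms by (simp_all add: Tychonoff_space_def)
  then obtain K:: "('a\<Rightarrow>real) set" and e
    where e: "embedding_map X (product_topology (\<lambda>f. top_of_set {0..1::real}) K) e"
    by (rule completely_regular_space_cube_embedding)
  show ?thesis
  proof (rule that[OF _ _ e])
    show "compact_space (product_topology (\<lambda>f. top_of_set {0..1::real}) K)"
      by (auto simp: compact_space_product_topology compact_space_subtopology)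
    show "Hausdorff_space (product_topology (\<lambda>f. top_of_set {0..1::real}) K)"
      by (auto simp: Hausdorff_space_product_topology Hausdorff_space_subtopology)
  qed
qed

lemma embedding_map_imp_continuous_injective:
  assumes "embedding_map X Q e"
  shows "continuous_map X Q e" and "inj_on e (topspace X)"
  using homeomorphic_imp_continuous_map[OF assms[unfolded embedding_map_def]]
    homeomorphic_imp_injective_map[OF assms[unfolded embedding_map_def]]
  by (simp_all add: continuous_map_in_subtopology)

lemma embedding_map_from_subtopology:
  assumes e: "embedding_map X Q e" and "A \<subseteq> topspace X"
  shows "embedding_map (subtopology X A) Q e"
proof -
  have "e ` topspace X \<subseteq> topspace Q"
    using embedding_map_imp_continuous_injective(1)[OF e]
    by (rule continuous_map_image_subset_topspace)
  then have "homeomorphic_map (subtopology X A) (subtopology (subtopology Q (e ` topspace X)) (e ` A)) e"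
    using assms(2) by (intro homeomorphic_map_subtopologies[OF e[unfolded embedding_map_def]]) auto
  moreover have "e ` topspace X \<inter> e ` A = e ` A" and "topspace X \<inter> A = A"
    using assms(2) by auto
  ultimately show ?thesis
    by (simp add: embedding_map_def subtopology_subtopology)
qed

text \<open>
  A proper map need not be injective, but adding the coordinate \<open>e\<close> makes it so, and a proper map
  paired with a continuous map into a Hausdorff space is proper. Hence the image is closed even
  though \<open>e\<close> itself need not have a closed image.
\<close>

lemma embedding_map_paired_proper_map:
  assumes e: "embedding_map X Q e" and Q: "Hausdorff_space Q"
    and \<phi>: "continuous_map X Y \<phi>" "proper_map X Y \<phi>"
  shows "embedding_map X (prod_topology Q Y) (\<lambda>x. (e x, \<phi> x))"
    and "closedin (prod_topology Q Y) ((\<lambda>x. (e x, \<phi> x)) ` topspace X)"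
proof -
  have e': "continuous_map X Q e" "inj_on e (topspace X)"
    using embedding_map_imp_continuous_injective[OF e] by auto
  have "proper_map X (prod_topology Q Y) (\<lambda>x. (e x, \<phi> x))"
    using e'(1) Q \<phi>(2) by (intro proper_map_paired) blast
  then have cl: "closed_map X (prod_topology Q Y) (\<lambda>x. (e x, \<phi> x))"
    by (rule proper_imp_closed_map)
  then show "closedin (prod_topology Q Y) ((\<lambda>x. (e x, \<phi> x)) ` topspace X)"
    by (simp add: closed_map_def)
  show "embedding_map X (prod_topology Q Y) (\<lambda>x. (e x, \<phi> x))"
    by (rule injective_closed_imp_embedding_map[OF _ cl])
      (use e' \<phi>(1) in \<open>auto simp: continuous_map_paired inj_on_def\<close>)
qed

section \<open>Frolik's characterization of Lindelof Cech-complete spaces\<close>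

text \<open>
  A Lindelof set is covered by countably many cozero sets inside \<open>U\<close>; their union is again a
  cozero set. The usual weighted sum of the defining functions is supplied by the distance on
  \<^typ>\<open>nat \<Rightarrow> real\<close>, which induces the product topology.
\<close>

lemma cozero_between_Lindelof_open:
  assumes X: "completely_regular_space X" and U: "openin X U" and "S \<subseteq> U"
    and L: "Lindelof_space (subtopology X S)"
  obtains h :: "'a \<Rightarrow> real" where "continuous_map X euclideanreal h" "\<And>x. x \<in> S \<Longrightarrow> h x > 0"
    "\<And>x. x \<in> topspace X - U \<Longrightarrow> h x = 0" 
proof (cases "S = {}")
  case True
  then show ?thesis by (intro that[of "\<lambda>_. 0"]) auto
next
  case False
  have "\<exists>f. continuous_map X euclideanreal f \<and> f x = 0 \<and> f ` (topspace X - U) \<subseteq> {1}" if "x \<in> S" for x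
    using X U \<open>S \<subseteq> U\<close> that unfolding completely_regular_space_alt' by blast
  then obtain g :: "'a \<Rightarrow> 'a \<Rightarrow> real" where g: "\<And>x. x \<in> S \<Longrightarrow> continuous_map X euclideanreal (g x)"
    "\<And>x. x \<in> S \<Longrightarrow> g x x = 0" "\<And>x. x \<in> S \<Longrightarrow> g x ` (topspace X - U) \<subseteq> {1}"
    by metis
  define V where "V x = {y \<in> topspace X. g x y \<in> {..<1}}" for x
  have SX: "S \<subseteq> topspace X"
    using openin_subset[OF U] \<open>S \<subseteq> U\<close> by blast
  have opV: "openin X (V x)" if "x \<in> S" for x
    unfolding V_def using g(1)[OF that] by (rule openin_continuous_map_preimage) auto
  have "S \<subseteq> \<Union>(V ` S)"
    using SX g(2) by (force simp: V_def)
  moreover have "\<forall>W\<in>V ` S. openin X W" using opV by blast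
  ultimately obtain \<V> where "countable \<V>" "\<V> \<subseteq> V ` S" and cov: "S \<subseteq> \<Union>\<V>"
    using L[unfolded Lindelof_space_subtopology_subset[OF SX]] by meson
  then obtain B where B: "countable B" "B \<subseteq> S" "\<V> = V ` B"
    by (meson countable_subset_image)
  with cov False have "B \<noteq> {}" by auto
  define b where "b = from_nat_into B"
  have rb: "range b = B"
    using B \<open>B \<noteq> {}\<close> by (simp add: b_def)
  then have bS: "b m \<in> S" for m using B by auto
  \<comment> \<open>The value is nonzero exactly where some \<open>g (b m)\<close> differs from 1, the value outside \<open>U\<close>.\<close>
  define h where "h y = dist (\<lambda>m. g (b m) y) (\<lambda>_. 1)" for y
  show ?thesis
  proof
    have "continuous_map X euclidean (\<lambda>y m. g (b m) y)"
      using g(1)[OF bS] by (simp add: continuous_map_euclidean_fun)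
    moreover have "continuous_map euclidean euclideanreal (\<lambda>z::nat \<Rightarrow> real. dist z (\<lambda>_. 1))"
      by (simp add: continuous_on_dist continuous_on_id)
    ultimately show "continuous_map X euclideanreal h"
      unfolding h_def by (rule continuous_map_compose[unfolded o_def])
  next
    fix x assume "x \<in> S"
    then obtain m where "x \<in> V (b m)" using cov B rb by auto
    then have "(\<lambda>m. g (b m) x) \<noteq> (\<lambda>_. 1)"
      by (auto simp: V_def fun_eq_iff intro!: exI[of _ m])
    then show "h x > 0" by (simp add: h_def)
  next
    fix x assume "x \<in> topspace X - U"
    then have "(\<lambda>m. g (b m) x) = (\<lambda>_. 1)"
      using g(3)[OF bS] by blast
    then show "h x = 0" by (simp add: h_def)
  qed
qed

text \<open>
  A \<open>G\<^sub>\<delta>\<close> set \<open>S\<close> in a compact Hausdorff space \<open>K\<close> which is Lindelof is an intersection of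
  countably many cozero sets \<open>{h n > 0}\<close>. The map \<open>\<psi> = (h n)\<^sub>n\<close> is proper since \<open>K\<close> is compact,
  and it remains proper as a map from \<open>S\<close>, the full preimage of the set of positive sequences,
  into that set. The logarithm makes the latter a whole power of the line, which is what allows an
  extension of the map from a \<open>C\<close>-embedded set with no control of the sign.
\<close>

lemma Lindelof_Cech_complete_imp_proper_map:
  assumes L: "Lindelof_space A" and C: "Cech_complete_space A"
  obtains \<phi> :: "'a \<Rightarrow> nat \<Rightarrow> real" where "continuous_map A euclidean \<phi>" "proper_map A euclidean \<phi>"
proof -
  obtain K :: "'a set set topology" and e where K: "compact_space K" "Hausdorff_space K"
    and e: "embedding_map A K e" and G: "gdelta_in K (e ` topspace A)"
    using C unfolding Cech_complete_space_def Hausdorff_compactification_def by blast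
  define S where "S = e ` topspace A"
  have e': "homeomorphic_map A (subtopology K S) e"
    using e by (simp add: embedding_map_def S_def)
  have LS: "Lindelof_space (subtopology K S)"
    by (rule Lindelof_space_continuous_map_image
        [OF L homeomorphic_imp_continuous_map[OF e'] homeomorphic_imp_surjective_map[OF e']])
  obtain U :: "nat \<Rightarrow> 'a set set set" where U: "\<And>n. openin K (U n)" "\<Inter>(range U) = S"
    using iffD1[OF gdelta_in_descending G] unfolding S_def[symmetric] by blast
  have cr: "completely_regular_space K"
    using K by (simp add: compact_Hausdorff_or_regular_imp_normal_space
        normal_imp_completely_regular_space)
  have "\<exists>h. continuous_map K euclideanreal h \<and> (\<forall>x\<in>S. h x > 0) \<and> (\<forall>x\<in>topspace K - U n. h x = 0)" for n
    by (rule cozero_between_Lindelof_open[OF cr U(1)[of n] _ LS]) (use U(2) in auto)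
  then obtain h where h: "\<And>n. continuous_map K euclideanreal (h n)"
      "\<And>n x. x \<in> S \<Longrightarrow> h n x > 0" "\<And>n x. x \<in> topspace K - U n \<Longrightarrow> h n x = 0"
    by metis
  define \<psi> where "\<psi> x n = h n x" for x n
  have c\<psi>: "continuous_map K euclidean \<psi>"
    by (simp add: continuous_map_euclidean_fun \<psi>_def h(1))
  have "proper_map K euclidean \<psi>"
    by (intro continuous_imp_proper_map K c\<psi> Hausdorff_imp_kc_space) simp
  moreover have eq: "{x \<in> topspace K. \<psi> x \<in> {y. \<forall>n. y n \<in> {0<..}}} = S" 
  proof -
    have "S \<subseteq> topspace K" using G gdelta_in_subset S_def by blast
    moreover have "x \<in> U n" if "x \<in> topspace K" "h n x > 0" for x n
      using h(3)[of x n] that by (cases "x \<in> U n") auto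
    ultimately show ?thesis
      unfolding U(2)[symmetric] \<psi>_def using h(2) U(2) by blast
  qed
  ultimately have p: "proper_map (subtopology K S) (top_of_set {y. \<forall>n. y n \<in> {0<..}}) \<psi>"
    by (rule proper_map_restriction)
  have c: "continuous_map (subtopology K S) (top_of_set {y. \<forall>n. y n \<in> {0<..}}) \<psi>"
    using c\<psi> eq by (auto simp: continuous_map_in_subtopology continuous_map_from_subtopology)
  have "homeomorphic_map (top_of_set {y :: nat \<Rightarrow> real. \<forall>n. y n \<in> {0<..}})
     (top_of_set {y. \<forall>n. y n \<in> UNIV}) (\<lambda>y n. ln (y n))"
    by (rule homeomorphic_map_componentwise[where g=exp]) (auto intro!: continuous_intros)
  then have l: "homeomorphic_map (top_of_set {y :: nat \<Rightarrow> real. \<forall>n. y n \<in> {0<..}})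
     euclidean (\<lambda>y n. ln (y n))" by simp
  show ?thesis
  proof
    show "continuous_map A euclidean ((\<lambda>y n. ln (y n)) \<circ> (\<psi> \<circ> e))"
      using continuous_map_compose[OF continuous_map_compose[OF homeomorphic_imp_continuous_map[OF e'] c]
        homeomorphic_imp_continuous_map[OF l]] by simp
    show "proper_map A euclidean ((\<lambda>y n. ln (y n)) \<circ> (\<psi> \<circ> e))"
      by (rule proper_map_compose[OF proper_map_compose[OF homeomorphic_imp_proper_map[OF e'] p]
        homeomorphic_imp_proper_map[OF l]])
  qed
qed

text \<open>
  Closed subsets of \<open>M\<close> need not be \<open>G\<^sub>\<delta>\<close>, so \<open>M\<close> is replaced by the closure of the image: there
  the image is the trace of \<open>N\<close>.
\<close>

lemma closedin_gdelta_in_compact_imp_Cech_complete_space: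
  assumes X: "Tychonoff_space X" and M: "compact_space M" "Hausdorff_space M"
    and E: "embedding_map X M E" and G: "gdelta_in M N"
    and R: "closedin (subtopology M N) (E ` topspace X)"
  shows "Cech_complete_space X"
proof (rule Cech_completeI[OF X])
  define C where "C = M closure_of (E ` topspace X)"
  have RN: "E ` topspace X \<subseteq> topspace M \<inter> N"
    using closedin_subset[OF R] by (simp add: topspace_subtopology)
  then have RC: "E ` topspace X \<subseteq> C"
    unfolding C_def by (intro closure_of_subset) auto
  have cl: "closedin M C" by (simp add: C_def)
  show "Hausdorff_compactification X (subtopology M C) E"
    unfolding Hausdorff_compactification_def
  proof (intro conjI)
    show "compact_space (subtopology M C)"
      using M(1) cl by (simp add: closedin_compact_space compact_space_subtopology)
    show "Hausdorff_space (subtopology M C)"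
      using M(2) by (simp add: Hausdorff_space_subtopology)
    show "embedding_map X (subtopology M C) E"
      using E RC by (auto simp: embedding_map_in_subtopology)
    show "subtopology M C closure_of (E ` topspace X) = topspace (subtopology M C)"
      using RC closedin_subset[OF cl]
      by (simp add: closure_of_subtopology Int_absorb1 Int_absorb2 flip: C_def)
  qed
  have "E ` topspace X = N \<inter> C"
    using closure_of_closedin[OF R] RN
    by (simp add: closure_of_subtopology Int_absorb1 C_def)
  then show "gdelta_in (subtopology M C) (E ` topspace X)"
    using G by (auto simp: gdelta_in_subtopology)
qed

text \<open>
  The converse direction of Frolik's theorem. Paired with an embedding into a compact
  space \<open>Q\<close>, the map \<open>\<phi>\<close> embeds \<open>X\<close> as a closed subset of the product of \<open>Q\<close> and a power of
  the real line. Then \<open>arctan\<close> turns the second factor into a power of an open interval, which is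
  a \<open>G\<^sub>\<delta>\<close> set in the power of the closed interval because there are countably many coordinates.
\<close>

lemma Tychonoff_proper_map_imp_Cech_complete:
  fixes \<phi> :: "'a \<Rightarrow> 'n::countable \<Rightarrow> real"
  assumes X: "Tychonoff_space X" and \<phi>: "continuous_map X euclidean \<phi>" "proper_map X euclidean \<phi>"
  shows "Cech_complete_space X"
proof -
  obtain Q :: "(('a \<Rightarrow> real) \<Rightarrow> real) topology" and e
    where Q: "compact_space Q" "Hausdorff_space Q" and e: "embedding_map X Q e"
    using Tychonoff_imp_embedding_in_compact_Hausdorff[OF X] by blast
  define D T :: "('n \<Rightarrow> real) set"
    where "D = {y. \<forall>n. y n \<in> {-(pi/2)..pi/2}}" and "T = {y. \<forall>n. y n \<in> {-(pi/2)<..<pi/2}}"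
  define E where "E x = (e x, \<lambda>n. arctan (\<phi> x n))" for x
  define M where "M = prod_topology Q (top_of_set D)"
  define N where "N = topspace Q \<times> T"
  have TD: "T \<subseteq> D" by (force simp: T_def D_def less_imp_le)
  have "homeomorphic_map (top_of_set {y :: 'n \<Rightarrow> real. \<forall>n. y n \<in> UNIV}) (top_of_set T) (\<lambda>y n. arctan (y n))"
    unfolding T_def
  proof (rule homeomorphic_map_componentwise[where g=tan])
    show "continuous_on {-(pi/2)<..<pi/2} tan"
      by (intro continuous_intros) (use cos_gt_zero_pi in force)
    show "range arctan \<subseteq> {-(pi/2)<..<pi/2}"
      using arctan_bounded by (metis greaterThanLessThan_iff image_subsetI)
  qed (auto intro!: continuous_intros simp: arctan_tan tan_arctan)
  then have a: "homeomorphic_map euclidean (top_of_set T) (\<lambda>y n. arctan (y n))" by simp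
  have a\<phi>: "continuous_map X (top_of_set T) (\<lambda>x n. arctan (\<phi> x n))"
      "proper_map X (top_of_set T) (\<lambda>x n. arctan (\<phi> x n))"
    using continuous_map_compose[OF \<phi>(1) homeomorphic_imp_continuous_map[OF a]]
      proper_map_compose[OF \<phi>(2) homeomorphic_imp_proper_map[OF a]] by (simp_all add: o_def)
  have MN: "prod_topology Q (top_of_set T) = subtopology M N"
    using TD unfolding M_def N_def
    by (metis prod_topology_subtopology(2) subtopology_Times subtopology_subtopology inf.absorb2 subtopology_topspace)
  have emb: "embedding_map X M E" and clo: "closedin (subtopology M N) (E ` topspace X)"
    using embedding_map_paired_proper_map[OF e Q(2) a\<phi>]
    unfolding MN E_def[symmetric] embedding_map_in_subtopology by blast+
  have GT: "gdelta_in M N"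
  proof -
    define W where "W n = {p \<in> topspace M. snd p n \<in> {-(pi/2)<..<pi/2}}" for n
    have cs: "continuous_map M euclideanreal (\<lambda>p. snd p n)" for n
    proof -
      have "continuous_map M euclidean snd"
        unfolding M_def using continuous_map_snd continuous_map_in_subtopology by blast
      then show ?thesis by (simp add: continuous_map_euclidean_fun)
    qed
    have "openin M (W n)" for n
      unfolding W_def by (rule openin_continuous_map_preimage[OF cs]) auto
    then have "gdelta_in M (\<Inter>(range W))"
      by (intro gdelta_in_Inter) (auto intro: open_imp_gdelta_in)
    moreover have "\<Inter>(range W) = N"
      using TD by (auto simp: W_def N_def M_def T_def subset_iff)
    ultimately show ?thesis by simp
  qed
  have "compact D"
  proof -
    have "D = PiE UNIV (\<lambda>_. {-(pi/2)..pi/2})" by (auto simp: D_def)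
    then have "compactin (product_topology (\<lambda>_. euclidean) UNIV) D"
      by (simp add: compactin_PiE)
    then show ?thesis
      by (simp add: euclidean_product_topology)
  qed
  show ?thesis
  proof (rule closedin_gdelta_in_compact_imp_Cech_complete_space[OF X _ _ emb GT clo])
    show "compact_space M"
      using Q \<open>compact D\<close> by (simp add: M_def compact_space_prod_topology compact_space_subtopology)
    show "Hausdorff_space M"
      using Q by (simp add: M_def Hausdorff_space_prod_topology Hausdorff_space_subtopology)
  qed
qed

section \<open>Products of proper maps\<close>

text \<open>
  The coordinates with index outside \<open>I\<close> are constant, so that one target space serves for all
  index sets.
\<close>

lemma continuous_map_into_fun_product:
  fixes \<phi> :: "'i \<Rightarrow> 'a \<Rightarrow> 'n \<Rightarrow> real"
  assumes "\<And>i. i \<in> I \<Longrightarrow> continuous_map (A i) euclidean (\<phi> i)"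
  shows "continuous_map (product_topology A I) euclidean
           (\<lambda>x (i, n). if i \<in> I then \<phi> i (x i) n else 0)"
  unfolding continuous_map_euclidean_fun
proof clarify
  fix i n
  show "continuous_map (product_topology A I) euclidean
          (\<lambda>x. if i \<in> I then \<phi> i (x i) n else 0)"
  proof (cases "i \<in> I")
    case True
    have "continuous_map (A i) euclidean (\<lambda>x. \<phi> i x n)"
      using assms[OF True] by (simp add: continuous_map_euclidean_fun)
    from continuous_map_compose[OF continuous_map_product_projection[OF True, of A] this]
    show ?thesis using True by (simp add: o_def)
  qed simp
qed

text \<open>
  The target is metrizable, so properness means that preimages of compact sets are compact. A
  compact set \<open>C\<close> lies in the product of its projections \<open>D i\<close>, hence its preimage is a closed
  subset of the product of the compact preimages of the \<open>D i\<close>, which is compact by Tychonoff's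
  theorem.
\<close>

lemma proper_map_into_fun_product:
  fixes \<phi> :: "'i::countable \<Rightarrow> 'a \<Rightarrow> 'n::countable \<Rightarrow> real"
  assumes c: "\<And>i. i \<in> I \<Longrightarrow> continuous_map (A i) euclidean (\<phi> i)"
    and p: "\<And>i. i \<in> I \<Longrightarrow> proper_map (A i) euclidean (\<phi> i)"
  shows "proper_map (product_topology A I) euclidean
           (\<lambda>x (i, n). if i \<in> I then \<phi> i (x i) n else 0)"
proof -
  let ?P = "product_topology A I"
  define \<Phi> where "\<Phi> x = (\<lambda>(i, n). if i \<in> I then \<phi> i (x i) n else 0)" for x
  have cont: "continuous_map ?P euclidean \<Phi>"
    unfolding \<Phi>_def using c by (rule continuous_map_into_fun_product)
  have "k_space (euclidean :: ('i \<times> 'n \<Rightarrow> real) topology)"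
    by (intro metrizable_imp_k_space metrizable_space_euclidean)
  then have "proper_map ?P euclidean \<Phi>"
  proof (subst proper_eq_compact_map)
    show "kc_space (euclidean :: ('i \<times> 'n \<Rightarrow> real) topology)"
      by (simp add: Hausdorff_imp_kc_space)
    show "\<Phi> \<in> topspace ?P \<rightarrow> topspace euclidean \<and>
      (\<forall>C. compactin euclidean C \<longrightarrow> compactin ?P {x \<in> topspace ?P. \<Phi> x \<in> C})"
    proof (intro conjI allI impI)
      fix C :: "('i \<times> 'n \<Rightarrow> real) set" assume "compactin euclidean C"
      then have C: "compact C" by simp
      define D where "D i = (\<lambda>y n. y (i, n)) ` C" for i
      have "compact (D i)" for i
        unfolding D_def using C
        by (intro compact_continuous_image continuous_on_coordinatewise_then_product) 
          (auto intro: continuous_on_subset[OF continuous_on_product_coordinates])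
      define L where "L i = {x \<in> topspace (A i). \<phi> i x \<in> D i}" for i
      have "compactin (A i) (L i)" if "i \<in> I" for i
        unfolding L_def by (rule compactin_proper_map_preimage[OF p[OF that]]) (simp add: \<open>compact (D i)\<close>)
      then have "compactin ?P (PiE I L)"
        by (simp add: compactin_PiE)
      moreover have "{x \<in> topspace ?P. \<Phi> x \<in> C} \<subseteq> PiE I L"
      proof clarify
        fix x assume x: "x \<in> topspace ?P" "\<Phi> x \<in> C"
        have "\<phi> i (x i) \<in> D i" if "i \<in> I" for i
          unfolding D_def using x(2) that by (intro image_eqI[OF _ x(2)]) (simp add: \<Phi>_def)
        then show "x \<in> PiE I L" using x(1) by (auto simp: L_def PiE_iff)
      qed
      moreover have "closedin ?P {x \<in> topspace ?P. \<Phi> x \<in> C}"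
        using cont C by (intro closedin_continuous_map_preimage[OF cont]) (simp add: compact_imp_closed)
      ultimately show "compactin ?P {x \<in> topspace ?P. \<Phi> x \<in> C}"
        using closed_compactin by blast
    qed auto
  qed (use cont in auto)
  then show ?thesis by (simp add: \<Phi>_def [abs_def])
qed

section \<open>\<open>C\<close>-embedding\<close>

lemma C_embedded_in_extend_fun:
  fixes \<phi> :: "'a \<Rightarrow> 'n \<Rightarrow> real"
  assumes "C_embedded_in X A" "continuous_map (subtopology X A) euclidean \<phi>"
  obtains \<Phi> where "continuous_map X euclidean \<Phi>" "\<And>x. x \<in> A \<Longrightarrow> \<Phi> x = \<phi> x"
proof -
  have "\<exists>g. continuous_map X euclideanreal g \<and> (\<forall>x\<in>A. g x = \<phi> x n)" for n
    using assms by (simp add: C_embedded_in_def continuous_map_euclidean_fun)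
  then obtain g where g: "\<And>n. continuous_map X euclideanreal (g n)" "\<And>n x. x \<in> A \<Longrightarrow> g n x = \<phi> x n"
    by metis
  show ?thesis
    by (rule that[of "\<lambda>x n. g n x"]) (auto simp: g continuous_map_euclidean_fun)
qed

text \<open>
  Pairing \<open>\<Phi>\<close> with an embedding into a compact space \<open>Q\<close> embeds \<open>A\<close> as a closed subset of
  \<open>Q \<times> Y\<close>, and it maps all of \<open>X\<close> continuously into this space. Since \<open>Q\<close> is compact, \<open>Q \<times> Y\<close> is
  regular and Lindelof along with \<open>Y\<close>, hence normal, and Tietze's theorem applies.
\<close>

lemma C_embedded_in_if_proper_map_extends:
  assumes X: "Tychonoff_space X" and AX: "A \<subseteq> topspace X"
    and Y: "regular_space Y" "Lindelof_space Y"
    and \<Phi>: "continuous_map X Y \<Phi>" "proper_map (subtopology X A) Y \<Phi>"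
  shows "C_embedded_in X A"
  unfolding C_embedded_in_def
proof (intro conjI allI impI AX)
  fix f :: "'a \<Rightarrow> real" assume f: "continuous_map (subtopology X A) euclideanreal f"
  obtain Q :: "(('a \<Rightarrow> real) \<Rightarrow> real) topology" and e
    where Q: "compact_space Q" "Hausdorff_space Q" and e: "embedding_map X Q e"
    using Tychonoff_imp_embedding_in_compact_Hausdorff[OF X] by blast
  let ?Z = "prod_topology Q Y"
  define E where "E x = (e x, \<Phi> x)" for x
  have tA: "topspace (subtopology X A) = A" using AX by auto
  have eA: "embedding_map (subtopology X A) Q e"
    using e AX by (rule embedding_map_from_subtopology)
  have cE: "continuous_map X ?Z E"
    unfolding E_def continuous_map_paired
    using \<Phi>(1) embedding_map_imp_continuous_injective(1)[OF e] by simp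
  have emb: "embedding_map (subtopology X A) ?Z E" and clo: "closedin ?Z (E ` A)"
    using embedding_map_paired_proper_map[OF eA Q(2) continuous_map_from_subtopology[OF \<Phi>(1)] \<Phi>(2)]
    unfolding E_def[symmetric] tA by auto
  have "regular_space ?Z"
    using Q Y(1) by (simp add: regular_space_prod_topology compact_Hausdorff_imp_regular_space)
  moreover have "Lindelof_space ?Z"
  proof (rule Lindelof_space_proper_map_preimage[OF _ Y(2)])
    show "proper_map ?Z Y snd"
      unfolding proper_map_def
    proof (intro conjI ballI)
      show "closed_map ?Z Y snd" using Q(1) by (rule closed_map_snd)
      fix y assume "y \<in> topspace Y"
      then have "{z \<in> topspace ?Z. snd z = y} = topspace Q \<times> {y}" by auto
      then show "compactin ?Z {z \<in> topspace ?Z. snd z = y}"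
        using Q(1) \<open>y \<in> topspace Y\<close> by (simp add: compactin_Times flip: compact_space_def)
    qed
  qed
  ultimately have norm: "normal_space ?Z"
    by (rule regular_Lindelof_imp_normal_space)
  obtain r where r: "homeomorphic_maps (subtopology X A) (subtopology ?Z (E ` A)) E r"
    using emb unfolding embedding_map_def homeomorphic_map_maps tA by blast
  then have rc: "continuous_map (subtopology ?Z (E ` A)) (subtopology X A) r"
    and rE: "\<And>x. x \<in> A \<Longrightarrow> r (E x) = x"
    unfolding homeomorphic_maps_def tA by auto
  obtain g where g: "continuous_map ?Z euclideanreal g" "\<And>z. z \<in> E ` A \<Longrightarrow> g z = (f \<circ> r) z"
    using Tietze_extension_realinterval[OF norm clo is_interval_univ _ continuous_map_compose[OF rc f]]
    by auto
  show "\<exists>g. continuous_map X euclideanreal g \<and> (\<forall>x\<in>A. g x = f x)"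
    using continuous_map_compose[OF cE g(1)] g(2) rE by (intro exI[of _ "g \<circ> E"]) auto
qed

theorem theorem2p5:
  fixes k :: enat and X :: "nat \<Rightarrow> 'a topology" and A :: "nat \<Rightarrow> 'a set"
  assumes "\<And>i. enat i < k \<Longrightarrow> Tychonoff_space (X i)"
    and "\<And>i. enat i < k \<Longrightarrow> C_embedded_in (X i) (A i)"
    and "\<And>i. enat i < k \<Longrightarrow> closedin (X i) (A i)"
    and "\<And>i. enat i < k \<Longrightarrow> Lindelof_space (subtopology (X i) (A i))"
    and "\<And>i. enat i < k \<Longrightarrow> Cech_complete_space (subtopology (X i) (A i))"
  shows "Lindelof_space (product_topology (\<lambda>i. subtopology (X i) (A i)) {i. enat i < k}) \<and>
         Cech_complete_space (product_topology (\<lambda>i. subtopology (X i) (A i)) {i. enat i < k}) \<and>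
         C_embedded_in (product_topology X {i. enat i < k}) (\<Pi>\<^sub>E i\<in>{i. enat i < k}. A i)"
proof -
  define I where "I = {i. enat i < k}"
  let ?A = "\<lambda>i. subtopology (X i) (A i)"
  have sub: "subtopology (product_topology X I) (\<Pi>\<^sub>E i\<in>I. A i) = product_topology ?A I"
    by (rule subtopology_product_topology)
  have AX: "A i \<subseteq> topspace (X i)" if "i \<in> I" for i
    using assms(2) that by (simp add: C_embedded_in_def I_def)
  have "\<exists>\<Phi> :: 'a \<Rightarrow> nat \<Rightarrow> real. continuous_map (X i) euclidean \<Phi> \<and> proper_map (?A i) euclidean \<Phi>"
    if "i \<in> I" for i
  proof -
    have i: "enat i < k" using that by (simp add: I_def)
    obtain \<phi> :: "'a \<Rightarrow> nat \<Rightarrow> real" where \<phi>: "continuous_map (?A i) euclidean \<phi>" "proper_map (?A i) euclidean \<phi>"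
      using Lindelof_Cech_complete_imp_proper_map[OF assms(4,5)[OF i]] by blast
    obtain \<Phi> where \<Phi>: "continuous_map (X i) euclidean \<Phi>" "\<And>x. x \<in> A i \<Longrightarrow> \<Phi> x = \<phi> x"
      using C_embedded_in_extend_fun[OF assms(2)[OF i] \<phi>(1)] by blast
    have "proper_map (?A i) euclidean \<Phi>"
    proof -
      have "\<Phi> ` S = \<phi> ` S" if "S \<subseteq> topspace (?A i)" for S
        using that \<Phi>(2) by (intro image_cong) auto
      moreover have "{x \<in> topspace (?A i). \<Phi> x = y} = {x \<in> topspace (?A i). \<phi> x = y}" for y
        using \<Phi>(2) by auto
      ultimately show ?thesis
        using \<phi>(2) closedin_subset[of "?A i"] unfolding proper_map_def closed_map_def by metis
    qed
    with \<Phi>(1) show ?thesis by blast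
  qed
  then obtain \<Phi> :: "nat \<Rightarrow> 'a \<Rightarrow> nat \<Rightarrow> real"
    where \<Phi>: "\<And>i. i \<in> I \<Longrightarrow> continuous_map (X i) euclidean (\<Phi> i)"
      "\<And>i. i \<in> I \<Longrightarrow> proper_map (?A i) euclidean (\<Phi> i)"
    by metis
  let ?\<Psi> = "\<lambda>x (i, n). if i \<in> I then \<Phi> i (x i) n else 0"
  have ext: "continuous_map (product_topology X I) euclidean ?\<Psi>"
    using \<Phi>(1) by (rule continuous_map_into_fun_product)
  have cont: "continuous_map (product_topology ?A I) euclidean ?\<Psi>"
    and proper: "proper_map (product_topology ?A I) euclidean ?\<Psi>"
    using \<Phi> by (auto intro: continuous_map_into_fun_product proper_map_into_fun_product
        continuous_map_from_subtopology)
  have Y: "regular_space (euclidean :: (nat \<times> nat \<Rightarrow> real) topology)"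
    "Lindelof_space (euclidean :: (nat \<times> nat \<Rightarrow> real) topology)"
    by (simp_all add: regular_space_euclidean second_countable_imp_Lindelof_space second_countable_euclidean)
  have T: "Tychonoff_space (product_topology X I)"
    using assms(1) by (intro Tychonoff_space_product_topology) (simp add: I_def)
  have TA: "Tychonoff_space (product_topology ?A I)"
    unfolding sub[symmetric] using T by (rule Tychonoff_space_subtopology)
  have "Lindelof_space (product_topology ?A I)"
    using proper Y(2) by (rule Lindelof_space_proper_map_preimage)
  moreover have "Cech_complete_space (product_topology ?A I)"
    using TA cont proper by (rule Tychonoff_proper_map_imp_Cech_complete)
  moreover have "C_embedded_in (product_topology X I) (\<Pi>\<^sub>E i\<in>I. A i)"
  proof (rule C_embedded_in_if_proper_map_extends[OF T _ Y ext])
    show "(\<Pi>\<^sub>E i\<in>I. A i) \<subseteq> topspace (product_topology X I)"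
      using AX by (auto simp: PiE_iff)
  qed (simp add: sub proper)
  ultimately show ?thesis
    unfolding I_def by blast
qed

end
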